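(* Let $D$ be a pre-divergence on a Polish space $\mathcal{X}$, $c$ a cost function, and $\mu\in\mathcal{P}(\mathcal{X})$, and assume $P\mapsto D(P\|\mu)$ is lower semicontinuous and has compact sublevel sets. Then $\nu\mapsto D^c(\nu\|\mu)$ is lower semicontinuous on $\mathcal{P}(\mathcal{X})$.
   Context: $\mathcal{P}(\mathcal{X})$ is the set of Borel probability measures on the Polish space $\mathcal{X}$ with the weak (Prokhorov) topology. A pre-divergence is $D:\mathcal{P}(\mathcal{X})\times\mathcal{P}(\mathcal{X})\to[0,\infty]$ with $D(\mu\|\mu)=0$ for all $\mu$. A cost function is a lower semicontinuous $c:\mathcal{X}\times\mathcal{X}\to[0,\infty]$, with OT cost $C(\mu,\nu)=\inf\{\int c\,d\pi:\pi_1=\mu,\pi_2=\nu\}$. $D^c(\nu\|\mu)=\inf_{\eta\in\mathcal{P}(\mathcal{X})}\{D(\eta\|\mu)+C(\eta,\nu)\}$. *)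

theory Defs
  imports "HOL-Probability.Probability"
begin

definition prob_measures :: "('a::topological_space) measure set" where
  "prob_measures = {P. sets P = sets (borel :: 'a measure) \<and> prob_space P}"

definition weak_topology :: "('a::topological_space) measure topology" where
  "weak_topology = topology_generated_by
     {{P \<in> prob_measures. (\<integral>x. f x \<partial>P) \<in> U} | f U.
        continuous_on UNIV f \<and> bounded (range f) \<and> open (U :: real set)}"

definition lsc_on :: "'b topology \<Rightarrow> ('b \<Rightarrow> ennreal) \<Rightarrow> bool" where
  "lsc_on T f \<longleftrightarrow> (\<forall>t. openin T {x \<in> topspace T. t < f x})"

definition pre_divergence :: "('a::topological_space measure \<Rightarrow> 'a measure \<Rightarrow> ennreal) \<Rightarrow> bool" where
  "pre_divergence D \<longleftrightarrow> (\<forall>\<mu>\<in>prob_measures. D \<mu> \<mu> = 0)"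

definition cost_function :: "('a::topological_space \<Rightarrow> 'a \<Rightarrow> ennreal) \<Rightarrow> bool" where
  "cost_function c \<longleftrightarrow> lsc_on euclidean (\<lambda>z. c (fst z) (snd z))"

definition couplings :: "'a::topological_space measure \<Rightarrow> 'a measure \<Rightarrow> ('a \<times> 'a) measure set" where
  "couplings \<mu> \<nu> = {\<pi>. \<pi> \<in> prob_measures \<and> distr \<pi> borel fst = \<mu> \<and> distr \<pi> borel snd = \<nu>}"

definition OT_cost :: "('a::topological_space \<Rightarrow> 'a \<Rightarrow> ennreal) \<Rightarrow> 'a measure \<Rightarrow> 'a measure \<Rightarrow> ennreal" where
  "OT_cost c \<mu> \<nu> = (INF \<pi>\<in>couplings \<mu> \<nu>. \<integral>\<^sup>+ z. c (fst z) (snd z) \<partial>\<pi>)"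

definition Dc :: "('a::topological_space measure \<Rightarrow> 'a measure \<Rightarrow> ennreal) \<Rightarrow> ('a \<Rightarrow> 'a \<Rightarrow> ennreal)
    \<Rightarrow> 'a measure \<Rightarrow> 'a measure \<Rightarrow> ennreal" where
  "Dc D c \<nu> \<mu> = (INF \<eta>\<in>prob_measures. D \<eta> \<mu> + OT_cost c \<eta> \<nu>)"

end

theory Submission
  imports Defs
begin

text \<open>
  The core is joint lower semicontinuity of the transport cost, obtained without Prokhorov's theorem.
  Suppose \<open>\<eta>\<^sub>n \<rightarrow> \<eta>\<close> and \<open>\<nu>\<^sub>n \<rightarrow> \<nu>\<close> weakly, with couplings \<open>\<pi>\<^sub>n\<close> of cost at most \<open>t + 1/(n + 1)\<close>. Choose a
  countable base of balls whose boundaries are null for \<open>\<eta>\<close> and \<open>\<nu>\<close>, and encode a point by the bit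
  sequence telling which balls contain it. The laws of the pairs of codes under \<open>\<pi>\<^sub>n\<close> have a
  subsequence along which all expectations of functions of finitely many bits converge to those of
  some law \<open>\<Lambda>\<close> (bit sequences embed in the real line, where Helly's theorem applies). The marginals
  of \<open>\<Lambda>\<close> are the laws of the codes of \<open>\<eta>\<close> and \<open>\<nu>\<close>, because the balls are continuity sets; so \<open>\<Lambda>\<close> is
  almost surely a pair of codes of points, and decoding it gives a coupling \<open>\<pi>\<close> of \<open>\<eta>\<close> and \<open>\<nu>\<close>. A lower
  semicontinuous cost is a countable supremum of nonnegative multiples of indicators of products of
  base balls, hence an increasing limit of functions of finitely many bits, and monotone convergence
  bounds the cost of \<open>\<pi>\<close> by \<open>t\<close>. Only countably many events matter, so sequences suffice even though
  no metrizability of the weak topology is established.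
\<close>

subsection \<open>Coding bit sequences by real numbers\<close>

definition code :: "(nat \<Rightarrow> bool) \<Rightarrow> real" where
  "code s = (\<Sum>k. 2 * of_bool (s k) / 4 ^ Suc k)"

text \<open>The base 4 digits used by \<^const>\<open>code\<close> are 0 and 2, so the fractional part of \<open>4 ^ k * code s\<close>
  lies in \<open>[0, 1/6]\<close> or \<open>[1/2, 2/3]\<close>; the function below is a continuous 1-periodic function of
  \<open>4 ^ k * z\<close> that is 0 on the first interval and 1 on the second.\<close>

definition digit :: "nat \<Rightarrow> real \<Rightarrow> real" where
  "digit k z = max 0 (min 1 (1/2 - cos (2 * pi * (4 ^ k * z) - pi / 6)))"

definition decode :: "real \<Rightarrow> nat \<Rightarrow> bool" where
  "decode z k \<longleftrightarrow> digit k z > 1/2"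

abbreviation bit_space :: "(nat \<Rightarrow> bool) measure" where
  "bit_space \<equiv> PiM UNIV (\<lambda>_. count_space UNIV)"

lemma code_sums: "(\<lambda>k. 2 / 4 ^ Suc k :: real) sums (2/3)"
proof -
  have "(\<lambda>k. (1/2) * (1/4) ^ k :: real) sums ((1/2) * (1 / (1 - 1/4)))"
    by (intro sums_mult geometric_sums) simp
  then show ?thesis by (simp add: power_divide)
qed

lemma code_summable: "summable (\<lambda>k. 2 * of_bool (s k) / 4 ^ Suc k :: real)"
  by (rule summable_comparison_test'[OF sums_summable[OF code_sums], of 0])
     (auto simp: field_simps)

lemma code_bounds: "0 \<le> code s" "code s \<le> 2/3"
proof -
  show "0 \<le> code s" unfolding code_def by (intro suminf_nonneg code_summable) auto
  have "code s \<le> (\<Sum>k. 2 / 4 ^ Suc k)"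
    unfolding code_def
    by (rule suminf_le[OF _ code_summable sums_summable[OF code_sums]]) auto
  also have "\<dots> = 2/3" using code_sums by (rule sums_unique[symmetric])
  finally show "code s \<le> 2/3" .
qed

text \<open>Tightness is stated with half-open intervals, so the left end must lie strictly below 0,
  the smallest code.\<close>

lemma code_less: "-1 < code s" "code s \<le> 1"
  using code_bounds[of s] by auto

text \<open>Multiplication by \<open>4 ^ k\<close> moves the digits before position \<open>k\<close>
  into the integer part. Bit \<open>k\<close> then contributes 2/4 and the remaining bits, one place
  further right, a quarter of their own code.\<close>

lemma code_shift:
  obtains m :: int where "4 ^ k * code s = of_int m + of_bool (s k) / 2 + code (\<lambda>i. s (i + Suc k)) / 4"
proof -
  define f :: "nat \<Rightarrow> real" where "f i = 2 * of_bool (s i) / 4 ^ Suc i" for i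
  have "code s = (\<Sum>i. f (i + Suc k)) + (\<Sum>i<Suc k. f i)"
    unfolding code_def f_def by (intro suminf_split_initial_segment code_summable)
  also have "(\<Sum>i. f (i + Suc k)) = (\<Sum>i. (1 / 4 ^ Suc k) * (2 * of_bool (s (i + Suc k)) / 4 ^ Suc i))"
    unfolding f_def by (intro suminf_cong) (simp add: power_add field_simps)
  also have "\<dots> = (1 / 4 ^ Suc k) * code (\<lambda>i. s (i + Suc k))"
    unfolding code_def by (intro suminf_mult code_summable)
  finally have *: "4 ^ k * code s = code (\<lambda>i. s (i + Suc k)) / 4 + (\<Sum>i<k. 4 ^ k * f i) + of_bool (s k) / 2"
    by (simp add: field_simps sum_distrib_left f_def)
  have "(\<Sum>i<k. 4 ^ k * f i) = of_int (\<Sum>i<k. 2 * of_bool (s i) * 4 ^ (k - Suc i))"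
    unfolding of_int_sum
  proof (intro sum.cong refl)
    fix i assume "i \<in> {..<k}"
    then have "4 ^ k = (4 ^ (k - Suc i) * 4 ^ Suc i :: real)"
      by (simp flip: power_add del: power_Suc)
    then show "4 ^ k * f i = of_int (2 * of_bool (s i) * 4 ^ (k - Suc i))"
      by (simp add: f_def)
  qed
  with * show ?thesis
    by (intro that[of "\<Sum>i<k. 2 * of_bool (s i) * 4 ^ (k - Suc i)"]) linarith
qed

lemma digit_code: "digit k (code s) = of_bool (s k)"
proof -
  obtain m :: int where m: "4 ^ k * code s = of_int m + of_bool (s k) / 2 + code (\<lambda>i. s (i + Suc k)) / 4"
    by (rule code_shift)
  define t where "t = code (\<lambda>i. s (i + Suc k)) / 4"
  have t: "0 \<le> t" "t \<le> 1/6"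
    using code_bounds[of "\<lambda>i. s (i + Suc k)"] by (auto simp: t_def)
  define x where "x = 2 * pi * t - pi / 6"
  have "pi * t \<le> pi * (1/6)" "0 \<le> pi * t"
    using t by (intro mult_left_mono mult_nonneg_nonneg; simp)+
  \<comment> \<open>This bound suffices for \<open>cos x\<close> to be at least 1/2. A set bit turns
    the angle by \<open>pi\<close> and flips the sign of the cosine, so the clamp in
    \<open>digit\<close> returns exactly 0 or 1.\<close>
  then have x: "\<bar>x\<bar> \<le> pi / 3"
    unfolding x_def by linarith
  have "cos (pi/3) \<le> cos \<bar>x\<bar>"
    using x by (intro cos_monotone_0_pi_le) auto
  then have c: "1/2 \<le> cos x" by (simp add: cos_60)
  have "2 * pi * (4 ^ k * code s) - pi / 6 = (x + pi * of_bool (s k)) + of_int m * (2 * pi)"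
    unfolding m t_def[symmetric] x_def by (simp add: algebra_simps)
  then have "cos (2 * pi * (4 ^ k * code s) - pi / 6) = cos (x + pi * of_bool (s k))"
    using cos_int_2pin[of m] sin_int_2pin[of m] by (simp add: cos_add mult.commute)
  then show ?thesis using c by (auto simp: digit_def)
qed

lemma decode_code: "decode (code s) = s"
  by (auto simp: fun_eq_iff decode_def digit_code)

lemma digit_bounds: "0 \<le> digit k z" "digit k z \<le> 1"
  by (auto simp: digit_def)

lemma continuous_digit: "continuous_on UNIV (digit k)"
  unfolding digit_def by (intro continuous_intros)

lemma measurable_digit [measurable]: "digit k \<in> borel_measurable borel"
  by (intro borel_measurable_continuous_onI continuous_digit)

lemma measurable_decode [measurable]: "decode \<in> measurable borel bit_space"
  by (rule measurable_PiM_single') (auto simp: decode_def)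

lemma measurable_bit [measurable]: "(\<lambda>s. s k) \<in> measurable bit_space (count_space UNIV)"
  by (rule measurable_component_singleton) simp

lemma measurable_code [measurable]: "code \<in> borel_measurable bit_space"
  unfolding code_def by measurable

subsection \<open>Sequential compactness for laws of bit sequences\<close>

definition depends_below :: "((nat \<Rightarrow> bool) \<Rightarrow> 'b) \<Rightarrow> nat \<Rightarrow> bool" where
  "depends_below f N \<longleftrightarrow> (\<forall>s s'. (\<forall>k<N. s k = s' k) \<longrightarrow> f s = f s')"

text \<open>Multilinear interpolation in the digits: the two functions obtained by fixing bit
  \<open>N\<close> are mixed with weights \<open>digit N z\<close> and \<open>1 - digit N z\<close>.
  Where every digit is 0 or 1 the mixture selects the right one. The bound \<open>B\<close> is
  carried along because weak convergence tests bounded continuous functions.\<close>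

lemma depends_below_interpolation:
  fixes f :: "(nat \<Rightarrow> bool) \<Rightarrow> real"
  assumes "depends_below f N"
  shows "\<exists>F B. continuous_on UNIV F \<and> (\<forall>z. \<bar>F z\<bar> \<le> B) \<and>
    (\<forall>z. (\<forall>k. digit k z \<in> {0, 1}) \<longrightarrow> F z = f (decode z))"
  using assms
proof (induction N arbitrary: f)
  case 0
  then have "f s = f (\<lambda>_. False)" for s by (simp add: depends_below_def)
  then show ?case by (intro exI[of _ "\<lambda>_. f (\<lambda>_. False)"] exI[of _ "\<bar>f (\<lambda>_. False)\<bar>"]) (metis continuous_on_const order_refl)
next
  case (Suc N)
  have "depends_below (\<lambda>s. f (s(N := b))) N" for b
    using Suc.prems unfolding depends_below_def by (auto simp: less_Suc_eq)
  then have "\<forall>b. \<exists>F B. continuous_on UNIV F \<and> (\<forall>z. \<bar>F z\<bar> \<le> B) \<and>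
    (\<forall>z. (\<forall>k. digit k z \<in> {0, 1}) \<longrightarrow> F z = f ((decode z)(N := b)))"
    using Suc.IH by blast
  then obtain F B where F: "\<And>b. continuous_on UNIV (F b)" "\<And>b z. \<bar>F b z\<bar> \<le> B b"
    "\<And>b z. (\<And>k. digit k z \<in> {0, 1}) \<Longrightarrow> F b z = f ((decode z)(N := b))"
    by metis
  define G where "G z = digit N z * F True z + (1 - digit N z) * F False z" for z
  have "continuous_on UNIV G"
    unfolding G_def by (intro continuous_intros continuous_digit F)
  moreover have "\<bar>G z\<bar> \<le> 1 * B True + 1 * B False" for z
  proof -
    have B: "0 \<le> B b" for b using F(2)[of b z] by linarith
    have "\<bar>digit N z\<bar> * \<bar>F True z\<bar> \<le> 1 * B True"
      using digit_bounds[of N z] by (intro mult_mono F(2) B) auto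
    moreover have "\<bar>1 - digit N z\<bar> * \<bar>F False z\<bar> \<le> 1 * B False"
      using digit_bounds[of N z] by (intro mult_mono F(2) B) auto
    ultimately show ?thesis
      unfolding G_def abs_mult[symmetric] by linarith
  qed
  moreover have "G z = f (decode z)" if z: "\<And>k. digit k z \<in> {0, 1}" for z
  proof -
    have "decode z N = (digit N z = 1)" using z[of N] by (auto simp: decode_def)
    then have "(decode z)(N := digit N z = 1) = decode z" by (simp add: fun_upd_idem)
    then show ?thesis using F(3)[OF z, of "digit N z = 1"] z[of N] by (auto simp: G_def)
  qed
  ultimately show ?case by blast
qed

text \<open>The laws of the codes all live on one bounded interval, so they are tight and have a
  weakly convergent subsequence. The limit charges only reals whose digits are all 0 or 1, where
  functions of finitely many bits agree with continuous interpolants; decoding the limit therefore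
  preserves the limits of their integrals.\<close>

lemma bit_space_compact:
  assumes Q: "\<And>n. prob_space (Q n)" "\<And>n. sets (Q n) = sets bit_space"
  obtains r \<Lambda> where "strict_mono (r :: nat \<Rightarrow> nat)" "prob_space \<Lambda>" "sets \<Lambda> = sets bit_space"
    "\<And>(f :: (nat \<Rightarrow> bool) \<Rightarrow> real) N. depends_below f N \<Longrightarrow>
      (\<lambda>n. \<integral>s. f s \<partial>Q (r n)) \<longlonglongrightarrow> (\<integral>s. f s \<partial>\<Lambda>)"
proof -
  note [measurable_cong] = Q(2)
  define R where "R n = distr (Q n) borel code" for n
  have rd: "real_distribution (R n)" for n
    unfolding R_def by (intro prob_space.real_distribution_distr Q) measurable
  have "tight R"
    unfolding tight_def
  proof (intro conjI allI impI rd)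
    fix e :: real assume "e > 0"
    have "measure (R n) {-1<..1} = measure (Q n) (space (Q n))" for n
      unfolding R_def by (subst measure_distr)
        (auto intro!: arg_cong[where f="measure (Q n)"] simp: code_less)
    then have "measure (R n) {-1<..1} > 1 - e" for n
      using \<open>e > 0\<close> prob_space.prob_space[OF Q(1)] by simp
    then show "\<exists>a b. a < b \<and> (\<forall>n. measure (R n) {a<..b} > 1 - e)"
      by (intro exI[where x="-1"] exI[where x=1 and P="\<lambda>b. -1 < b \<and> (\<forall>n. measure (R n) {-1<..b} > 1 - e)"]) auto
  qed
  from tight_imp_convergent_subsubsequence[OF this, of id]
  obtain r M where r: "strict_mono r" and M: "real_distribution M" and w: "weak_conv_m (R \<circ> r) M"
    by (auto simp: strict_mono_def)
  interpret M: real_distribution M by fact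
  have sets_M [measurable_cong]: "sets M = sets borel" by simp
  have conv: "(\<lambda>n. \<integral>s. F (code s) \<partial>Q (r n)) \<longlonglongrightarrow> (\<integral>z. F z \<partial>M)"
    if F: "continuous_on UNIV F" "\<And>z. \<bar>F z\<bar> \<le> B" for F :: "real \<Rightarrow> real" and B
  proof -
    have [measurable]: "F \<in> borel_measurable borel"
      using F by (intro borel_measurable_continuous_onI)
    have "(\<lambda>n. \<integral>z. F z \<partial>(R \<circ> r) n) \<longlonglongrightarrow> (\<integral>z. F z \<partial>M)"
      using F by (intro weak_conv_imp_integral_bdd_continuous_conv[OF _ M w, of _ B])
        (auto simp: rd continuous_on_eq_continuous_at)
    then show ?thesis by (simp add: R_def integral_distr)
  qed
  \<comment> \<open>The function \<open>digit k z * (1 - digit k z)\<close> is continuous, bounded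
    and nonnegative, and it vanishes on codes. Its integral against the limit is thus 0, so it
    vanishes almost everywhere.\<close>
  have "AE z in M. digit k z \<in> {0,1}" for k
  proof -
    have p: "0 \<le> digit k z * (1 - digit k z)" "digit k z * (1 - digit k z) \<le> 1" for z
      using digit_bounds[of k z] mult_mono[of "digit k z" 1 "1 - digit k z" 1] by auto
    have "(\<lambda>n. \<integral>s. digit k (code s) * (1 - digit k (code s)) \<partial>Q (r n)) \<longlonglongrightarrow> (\<integral>z. digit k z * (1 - digit k z) \<partial>M)"
      using p by (intro conv[OF _ abs_leI]) (auto intro!: continuous_intros continuous_digit order_trans[of "- _" 0 1])
    moreover have "of_bool b * (1 - of_bool b) = (0::real)" for b by auto
    ultimately have "(\<integral>z. digit k z * (1 - digit k z) \<partial>M) = 0"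
      by (simp add: digit_code LIMSEQ_const_iff del: of_bool_eq_0_iff)
    then have "AE z in M. digit k z * (1 - digit k z) = 0"
      using p by (subst (asm) integral_nonneg_eq_0_iff_AE)
        (auto intro!: M.integrable_const_bound[where B=1])
    then show ?thesis by eventually_elim auto
  qed
  then have ae: "AE z in M. \<forall>k. digit k z \<in> {0,1}"
    by (subst AE_all_countable) auto
  define \<Lambda> where "\<Lambda> = distr M bit_space decode"
  show ?thesis
  proof (rule that[OF r, of \<Lambda>])
    show "prob_space \<Lambda>" unfolding \<Lambda>_def by (intro M.prob_space_distr) measurable
    show "sets \<Lambda> = sets bit_space" by (simp add: \<Lambda>_def)
    fix f :: "(nat \<Rightarrow> bool) \<Rightarrow> real" and N assume f: "depends_below f N"
    obtain F B where F: "continuous_on UNIV F" "\<And>z. \<bar>F z\<bar> \<le> B"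
      "\<And>z. (\<And>k. digit k z \<in> {0, 1}) \<Longrightarrow> F z = f (decode z)"
      using depends_below_interpolation[OF f] by blast
    have [measurable]: "F \<in> borel_measurable borel"
      using F by (intro borel_measurable_continuous_onI)
    \<comment> \<open>Every bit sequence is recovered from its code, so \<open>f\<close> factors
      through the continuous \<open>F\<close>; this also yields the measurability of
      \<open>f\<close>.\<close>
    have Fc: "F (code s) = f s" for s
      using F(3)[of "code s"] by (simp add: digit_code decode_code)
    then have f_eq: "f = (\<lambda>s. F (code s))" by auto
    have [measurable]: "f \<in> borel_measurable bit_space"
      unfolding f_eq by measurable
    have "(\<integral>s. f s \<partial>\<Lambda>) = (\<integral>z. f (decode z) \<partial>M)"
      unfolding \<Lambda>_def by (rule integral_distr) measurable
    also have "\<dots> = (\<integral>z. F z \<partial>M)"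
      using ae F(3) by (intro integral_cong_AE) (auto elim!: eventually_mono)
    finally show "(\<lambda>n. \<integral>s. f s \<partial>Q (r n)) \<longlonglongrightarrow> (\<integral>s. f s \<partial>\<Lambda>)"
      using conv[OF F(1,2)] by (simp add: Fc)
  qed
qed

subsection \<open>Continuity sets in the weak topology\<close>

lemma topspace_weak_topology [simp]: "topspace weak_topology = prob_measures"
proof -
  have "{P \<in> prob_measures. (\<integral>x. (0::real) \<partial>P) \<in> UNIV} \<in> {{P \<in> prob_measures. (\<integral>x. f x \<partial>P) \<in> U} | f U.
        continuous_on UNIV f \<and> bounded (range f) \<and> open (U :: real set)}"
    by (intro CollectI exI[of _ "\<lambda>_. 0"] exI[of _ UNIV]) auto
  then show ?thesis
    unfolding weak_topology_def by auto
qed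

lemma openin_weak_topology_integral:
  fixes f :: "'a::topological_space \<Rightarrow> real"
  assumes "continuous_on UNIV f" "bounded (range f)" "open U"
  shows "openin weak_topology {P \<in> prob_measures. (\<integral>x. f x \<partial>P) \<in> U}"
  unfolding weak_topology_def using assms by (intro topology_generated_by_Basis) blast

text \<open>The sets of the portmanteau theorem: on a metric space, evaluation of probability
  measures at such a set is weakly continuous at \<eta>.\<close>

definition continuity_set :: "'a::topological_space measure \<Rightarrow> 'a set \<Rightarrow> bool" where
  "continuity_set \<eta> B \<longleftrightarrow> B \<in> sets borel \<and> measure \<eta> (frontier B) = 0"

lemma prob_measuresD:
  assumes "P \<in> prob_measures"
  shows "prob_space P" "sets P = sets borel" "space P = UNIV"
  using assms sets_eq_imp_space_eq[of P borel] by (auto simp: prob_measures_def)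

lemma continuity_set_Compl: "continuity_set \<eta> B \<Longrightarrow> continuity_set \<eta> (- B)"
  by (auto simp: continuity_set_def frontier_complement)

text \<open>The frontier of an intersection lies in the union of the frontiers.\<close>

lemma continuity_set_Int:
  assumes P: "\<eta> \<in> prob_measures" and B: "continuity_set \<eta> B" and C: "continuity_set \<eta> C"
  shows "continuity_set \<eta> (B \<inter> C)"
proof -
  interpret prob_space \<eta> using prob_measuresD[OF P] by auto
  note [simp] = prob_measuresD(2)[OF P]
  have "measure \<eta> (frontier (B \<inter> C)) \<le> measure \<eta> (frontier B \<union> frontier C)"
    by (intro finite_measure_mono) (auto dest: frontier_Int_subset[THEN subsetD] intro: borel_closed)
  also have "\<dots> \<le> measure \<eta> (frontier B) + measure \<eta> (frontier C)"
    by (intro measure_Un_le) (auto intro: borel_closed)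
  finally show ?thesis
    using B C measure_nonneg[of \<eta> "frontier (B \<inter> C)"] by (auto simp: continuity_set_def intro!: antisym)
qed

lemma continuity_set_UNIV: "continuity_set \<eta> UNIV"
  by (simp add: continuity_set_def)

text \<open>Continuous cutoffs \<open>f n\<close> dominate the indicator of \<open>B\<close> and
  decrease to that of its closure, which has the same \<eta>-measure because the frontier is null. A
  single cutoff whose \<eta>-integral is below \<open>measure \<eta> B + e\<close> defines the
  neighbourhood.\<close>

lemma weak_neighbourhood_upper:
  fixes \<eta> :: "'a::metric_space measure"
  assumes \<eta>: "\<eta> \<in> prob_measures" and B: "continuity_set \<eta> B" and e: "e > 0"
  shows "\<exists>S. openin weak_topology S \<and> \<eta> \<in> S \<and> (\<forall>P\<in>S. measure P B < measure \<eta> B + e)"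
\<comment> \<open>The empty set is treated apart because \<open>infdist\<close> to it is 0 by
  convention, which would make every cutoff constantly 1.\<close>
proof (cases "B = {}")
  case True
  then show ?thesis
    using \<eta> e by (intro exI[of _ "prob_measures"]) (metis add.left_neutral measure_empty openin_topspace topspace_weak_topology)
next
  case False
  interpret prob_space \<eta> using prob_measuresD[OF \<eta>] by auto
  note [measurable_cong] = prob_measuresD(2)[OF \<eta>]
  have [measurable]: "B \<in> sets borel" using B by (auto simp: continuity_set_def)
  define f where "f n x = max 0 (1 - real n * infdist x (closure B))" for n x
  have cont: "continuous_on UNIV (f n)" for n
    unfolding f_def by (intro continuous_intros)
  have [measurable]: "f n \<in> borel_measurable borel" for n
    by (intro borel_measurable_continuous_onI cont)
  have bd: "0 \<le> f n x" "f n x \<le> 1" for n x by (auto simp: f_def infdist_nonneg)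
  have ind: "indicator B x \<le> f n x" for n x
    using closure_subset[of B] by (auto simp: f_def indicator_def)
  have "(\<lambda>n. f n x) \<longlonglongrightarrow> indicator (closure B) x" for x
  proof (cases "x \<in> closure B")
    case True then show ?thesis by (simp add: f_def)
  next
    case F: False
    have pos: "infdist x (closure B) > 0"
      using F False infdist_nonneg[of x "closure B"]
      by (metis closed_closure closure_eq_empty in_closed_iff_infdist_zero order_le_less)
    obtain N :: nat where "1 < N * infdist x (closure B)"
      using ex_less_of_nat_mult[OF pos] by blast
    then have "1 < n * infdist x (closure B)" if "n \<ge> N" for n
      using that pos by (meson less_le_trans mult_right_mono of_nat_mono less_imp_le)
    then have "f n x = 0" if "n \<ge> N" for n
      using that by (fastforce simp: f_def)
    then show ?thesis
      using F by (intro tendsto_eventually) (auto simp: eventually_sequentially)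
  qed
  then have "(\<lambda>n. \<integral>x. f n x \<partial>\<eta>) \<longlonglongrightarrow> (\<integral>x. indicator (closure B) x \<partial>\<eta>)"
    using bd by (intro integral_dominated_convergence[where w="\<lambda>_. 1"]) (auto intro!: borel_measurable_indicator)
  also have "(\<integral>x. indicator (closure B) x \<partial>\<eta>) = measure \<eta> (closure B)"
    by (simp add: prob_measuresD(3)[OF \<eta>])
  also have "measure \<eta> (closure B) = measure \<eta> B"
  proof -
    have "measure \<eta> (closure B) \<le> measure \<eta> (B \<union> frontier B)"
      by (intro finite_measure_mono) (auto simp: frontier_def dest: interior_subset[THEN subsetD])
    also have "\<dots> \<le> measure \<eta> B + measure \<eta> (frontier B)"
      by (intro measure_Un_le) auto
    finally show ?thesis
      using B finite_measure_mono[of B "closure B"] closure_subset[of B]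
      by (auto simp: continuity_set_def intro!: antisym)
  qed
  finally have "eventually (\<lambda>n. (\<integral>x. f n x \<partial>\<eta>) < measure \<eta> B + e) sequentially"
    using e by (intro order_tendstoD) auto
  then obtain n where n: "(\<integral>x. f n x \<partial>\<eta>) < measure \<eta> B + e"
    by (auto simp: eventually_sequentially)
  let ?S = "{P \<in> prob_measures. (\<integral>x. f n x \<partial>P) \<in> {..<measure \<eta> B + e}}"
  have "openin weak_topology ?S"
    using bd by (intro openin_weak_topology_integral cont) (auto simp: bounded_iff intro!: exI[of _ 1])
  moreover have "measure P B < measure \<eta> B + e" if P: "P \<in> ?S" for P
  proof -
    have P': "P \<in> prob_measures" using P by auto
    interpret P: prob_space P using prob_measuresD[OF P'] by auto
    note [measurable_cong] = prob_measuresD(2)[OF P']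
    have "measure P B = (\<integral>x. indicator B x \<partial>P)"
      by (simp add: prob_measuresD(3)[OF P'])
    also have "\<dots> \<le> (\<integral>x. f n x \<partial>P)"
      using bd by (intro integral_mono ind P.integrable_const_bound[where B=1]) auto
    also have "\<dots> < measure \<eta> B + e" using P by auto
    finally show ?thesis .
  qed
  ultimately show ?thesis using n \<eta> by blast
qed

text \<open>The lower estimate is the upper estimate for the complement, as all masses are
  1.\<close>

lemma weak_neighbourhood:
  fixes \<eta> :: "'a::metric_space measure"
  assumes \<eta>: "\<eta> \<in> prob_measures" and B: "continuity_set \<eta> B" and e: "e > 0"
  shows "\<exists>S. openin weak_topology S \<and> \<eta> \<in> S \<and> (\<forall>P\<in>S. \<bar>measure P B - measure \<eta> B\<bar> < e)"
proof -
  obtain S T where S: "openin weak_topology S" "\<eta> \<in> S" "\<And>P. P \<in> S \<Longrightarrow> measure P B < measure \<eta> B + e"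
    and T: "openin weak_topology T" "\<eta> \<in> T" "\<And>P. P \<in> T \<Longrightarrow> measure P (- B) < measure \<eta> (- B) + e"
    using weak_neighbourhood_upper[OF \<eta> B e] weak_neighbourhood_upper[OF \<eta> continuity_set_Compl[OF B] e] by blast
  have compl: "measure P (- B) = 1 - measure P B" if P: "P \<in> prob_measures" for P
    using prob_space.prob_compl[of P B] prob_measuresD[OF P] B
    by (simp add: continuity_set_def Compl_eq_Diff_UNIV)
  have "\<bar>measure P B - measure \<eta> B\<bar> < e" if "P \<in> S" "P \<in> T" for P
  proof -
    have "P \<in> prob_measures" using that S(1) openin_subset by fastforce
    then show ?thesis using S(3) T(3) that compl[of P] compl[OF \<eta>] by fastforce
  qed
  then show ?thesis using S T by (intro exI[of _ "S \<inter> T"]) auto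
qed

section \<open>Base balls with null boundaries\<close>

lemma null_spheres:
  fixes x :: "'a::{metric_space, second_countable_topology}"
  assumes "\<eta> \<in> prob_measures"
  shows "countable {r. measure \<eta> (sphere x r) \<noteq> 0}"
proof -
  interpret prob_space \<eta> using prob_measuresD[OF assms] by auto
  note [measurable_cong] = prob_measuresD(2)[OF assms]
  interpret D: prob_space "distr \<eta> borel (dist x)" by (intro prob_space_distr) measurable
  \<comment> \<open>Spheres about \<open>x\<close> are the level sets of the distance to
    \<open>x\<close>, so those of positive mass correspond to atoms of a law on the line, of which
    there are only countably many.\<close>
  have "measure (distr \<eta> borel (dist x)) {r} = measure \<eta> (sphere x r)" for r
    by (subst measure_distr) (auto simp: prob_measuresD(3)[OF assms] intro!: arg_cong[where f="measure \<eta>"])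
  then show ?thesis using D.countable_support by simp
qed

text \<open>The centres are a dense sequence. Each interval allowed for a radius is uncountable,
  while only countably many radii give a sphere charged by one of the two measures.\<close>

lemma continuity_balls:
  fixes \<eta> \<nu> :: "'a::{metric_space, second_countable_topology} measure"
  assumes "\<eta> \<in> prob_measures" "\<nu> \<in> prob_measures"
  obtains x :: "nat \<Rightarrow> 'a" and r :: "nat \<Rightarrow> nat \<Rightarrow> real" where
    "\<And>U. open U \<Longrightarrow> U \<noteq> {} \<Longrightarrow> \<exists>i. x i \<in> U"
    "\<And>i m. 1 / (real m + 2) < r i m" "\<And>i m. r i m < 1 / (real m + 1)"
    "\<And>i m. continuity_set \<eta> (ball (x i) (r i m))" "\<And>i m. continuity_set \<nu> (ball (x i) (r i m))"
proof -
  obtain D :: "'a set" where D: "countable D" "\<And>U. open U \<Longrightarrow> U \<noteq> {} \<Longrightarrow> \<exists>d\<in>D. d \<in> U"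
    using countable_dense_exists[where 'a='a] by blast
  then have "D \<noteq> {}" using D(2)[of UNIV] by auto
  define x where "x = from_nat_into D"
  have rx: "range x = D" unfolding x_def using D \<open>D \<noteq> {}\<close> by (intro range_from_nat_into)
  have "\<exists>r. 1 / (real m + 2) < r \<and> r < 1 / (real m + 1) \<and> continuity_set \<eta> (ball (x i) r)
     \<and> continuity_set \<nu> (ball (x i) r)" for i m
  proof -
    let ?C = "{r. measure \<eta> (sphere (x i) r) \<noteq> 0} \<union> {r. measure \<nu> (sphere (x i) r) \<noteq> 0}"
    have "countable ?C" using null_spheres[OF assms(1)] null_spheres[OF assms(2)] by auto
    moreover have "uncountable {1 / (real m + 2)<..<1 / (real m + 1)}"
      by (subst uncountable_open_interval) (simp add: field_simps)
    ultimately obtain r where r: "r \<in> {1 / (real m + 2)<..<1 / (real m + 1)}" "r \<notin> ?C"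
      by (metis countable_subset subsetI)
    have cs: "continuity_set P (ball (x i) r)" if "P \<in> prob_measures" "measure P (sphere (x i) r) = 0" for P
    proof -
      interpret prob_space P using prob_measuresD[OF that(1)] by auto
      have "frontier (ball (x i) r) \<subseteq> sphere (x i) r"
        by (auto simp: frontier_def interior_open dest: closure_minimal[OF ball_subset_cball closed_cball, THEN subsetD])
      moreover have "sphere (x i) r \<in> sets borel"
        unfolding sphere_def by measurable
      ultimately have "measure P (frontier (ball (x i) r)) \<le> measure P (sphere (x i) r)"
        using prob_measuresD(2)[OF that(1)] by (intro finite_measure_mono) auto
      then show ?thesis using that by (simp add: continuity_set_def measure_le_0_iff)
    qed
    show ?thesis using r cs assms by (intro exI[of _ r]) auto
  qed
  then have "\<forall>i. \<exists>r. \<forall>m. 1 / (real m + 2) < r m \<and> r m < 1 / (real m + 1) \<and> continuity_set \<eta> (ball (x i) (r m))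
     \<and> continuity_set \<nu> (ball (x i) (r m))" by (intro allI choice)
  from choice[OF this] obtain r where "\<And>i m. 1 / (real m + 2) < r i m" "\<And>i m. r i m < 1 / (real m + 1)"
    "\<And>i m. continuity_set \<eta> (ball (x i) (r i m))" "\<And>i m. continuity_set \<nu> (ball (x i) (r i m))" by blast
  moreover have "\<exists>i. x i \<in> U" if "open U" "U \<noteq> {}" for U
    using D(2)[OF that] rx by (metis rangeE)
  ultimately show ?thesis using that by blast
qed

subsection \<open>Points as bit sequences\<close>

text \<open>The lower bound on the radii makes the balls of each level \<open>m\<close> cover the
  space; the upper bound makes them shrink as \<open>m\<close> grows.\<close>

locale ball_coding =
  fixes x :: "nat \<Rightarrow> 'a::polish_space" and r :: "nat \<Rightarrow> nat \<Rightarrow> real"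
  assumes dense: "\<And>U. open U \<Longrightarrow> U \<noteq> {} \<Longrightarrow> \<exists>i. x i \<in> U"
    and r_gt: "\<And>i m. 1 / (real m + 2) < r i m"
    and r_less: "\<And>i m. r i m < 1 / (real m + 1)"
begin

definition code_ball :: "nat \<Rightarrow> 'a set" where
  "code_ball j = (case prod_decode j of (i, m) \<Rightarrow> ball (x i) (r i m))"

definition encode :: "'a \<Rightarrow> nat \<Rightarrow> bool" where
  "encode y j \<longleftrightarrow> y \<in> code_ball j"

text \<open>An approximation of the coded point: the centre of the first ball of level
  \<open>m\<close> marked by \<open>s\<close>. If \<open>s\<close> marks none, the value is
  unspecified.\<close>

definition center :: "nat \<Rightarrow> (nat \<Rightarrow> bool) \<Rightarrow> 'a" where
  "center m s = x (LEAST i. s (prod_encode (i, m)))"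

text \<open>The fallback \<open>x 0\<close> makes the sequence converge for every \<open>s\<close>,
  code or not, so that \<open>point\<close> is a pointwise limit of measurable functions.\<close>

definition point :: "(nat \<Rightarrow> bool) \<Rightarrow> 'a" where
  "point s = lim (\<lambda>m. if Cauchy (\<lambda>m. center m s) then center m s else x 0)"

lemma open_code_ball: "open (code_ball j)"
  by (simp add: code_ball_def split: prod.splits)

lemma ex_code_ball: "\<exists>i. y \<in> code_ball (prod_encode (i, m))"
proof -
  have "0 < 1 / (real m + 2)" by simp
  then obtain i where "x i \<in> ball y (1 / (real m + 2))"
    using dense[of "ball y (1 / (real m + 2))"] by (metis centre_in_ball empty_iff open_ball)
  then have "y \<in> ball (x i) (r i m)" using r_gt[of m i] by (auto simp: dist_commute)
  then show ?thesis by (auto simp: code_ball_def)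
qed

lemma code_ball_diameter:
  assumes "y \<in> code_ball (prod_encode (i, m))"
  shows "dist (x i) y < 1 / (real m + 1)"
  using assms r_less[of i m] by (simp add: code_ball_def)

lemma code_ball_basis:
  assumes "open U" "y \<in> U"
  obtains j where "y \<in> code_ball j" "code_ball j \<subseteq> U"
proof -
  obtain e where e: "e > 0" "ball y e \<subseteq> U" using assms by (auto simp: open_contains_ball)
  obtain m :: nat where m: "1 / (real m + 1) < e / 2"
    using e reals_Archimedean[of "e/2"] by (auto simp: inverse_eq_divide add.commute)
  obtain i where i: "y \<in> code_ball (prod_encode (i, m))" using ex_code_ball by blast
  have "code_ball (prod_encode (i, m)) \<subseteq> ball y e"
  proof
    fix z assume "z \<in> code_ball (prod_encode (i, m))"
    then have "dist (x i) z < e/2" "dist (x i) y < e/2"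
      using code_ball_diameter[OF i] code_ball_diameter[of z i m] m by linarith+
    then show "z \<in> ball y e" using dist_triangle_half_r[of "x i" y e z] by auto
  qed
  then show ?thesis using that i e by blast
qed

text \<open>The ball selected at level \<open>m\<close> contains \<open>y\<close>, so its centre is
  within \<open>1 / (m + 1)\<close> of \<open>y\<close>.\<close>

lemma point_encode: "point (encode y) = y"
proof -
  have "dist (center m (encode y)) y < 1 / (real m + 1)" for m
  proof -
    have "encode y (prod_encode (LEAST i. encode y (prod_encode (i, m)), m))"
      using ex_code_ball[of y m] LeastI_ex[where P="\<lambda>i. encode y (prod_encode (i, m))"] by (simp add: encode_def)
    then show ?thesis using code_ball_diameter by (auto simp: encode_def center_def)
  qed
  then have "(\<lambda>m. dist (center m (encode y)) y) \<longlonglongrightarrow> 0"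
    by (intro real_tendsto_sandwich[OF _ _ tendsto_const LIMSEQ_inverse_real_of_nat])
       (auto simp: inverse_eq_divide add.commute intro!: always_eventually less_imp_le)
  then have L: "(\<lambda>m. center m (encode y)) \<longlonglongrightarrow> y"
    by (subst tendsto_dist_iff)
  then show ?thesis
    using limI[OF L] by (simp add: point_def LIMSEQ_imp_Cauchy)
qed

lemma measurable_encode [measurable]: "encode \<in> measurable borel bit_space"
proof (rule measurable_PiM_single')
  fix j
  have [measurable]: "code_ball j \<in> sets borel" using open_code_ball by (rule borel_open)
  show "(\<lambda>y. encode y j) \<in> borel \<rightarrow>\<^sub>M count_space UNIV"
    unfolding encode_def by measurable
qed (simp add: space_PiM PiE_UNIV_domain)

lemma measurable_center [measurable]: "center m \<in> borel_measurable bit_space"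
proof -
  have "(\<lambda>s. LEAST i. s (prod_encode (i, m))) \<in> measurable bit_space (count_space UNIV)"
    by (intro measurable_Least) measurable
  then show ?thesis unfolding center_def by (rule measurable_compose) simp
qed

lemma measurable_point [measurable]: "point \<in> borel_measurable bit_space"
proof (rule borel_measurable_LIMSEQ_metric)
  show "(\<lambda>s. if Cauchy (\<lambda>m. center m s) then center m s else x 0) \<in> borel_measurable bit_space" for m
    by measurable
  fix s
  have "convergent (\<lambda>m. if Cauchy (\<lambda>m. center m s) then center m s else x 0)"
    by (cases "Cauchy (\<lambda>m. center m s)") (simp_all add: Cauchy_convergent_iff convergent_const)
  then show "(\<lambda>m. if Cauchy (\<lambda>m. center m s) then center m s else x 0) \<longlonglongrightarrow> point s"
    unfolding point_def by (simp add: convergent_LIMSEQ_iff)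
qed

end

subsection \<open>Limits of couplings\<close>

text \<open>Interleaving turns a pair of codes into one bit sequence, so that compactness for laws
  of single sequences also covers couplings.\<close>

definition pair_bits :: "(nat \<Rightarrow> bool) \<Rightarrow> (nat \<Rightarrow> bool) \<Rightarrow> nat \<Rightarrow> bool" where
  "pair_bits s t k = (if even k then s (k div 2) else t (k div 2))"

lemma pair_bits_simps [simp]:
  "pair_bits s t (2 * k) = s k" "pair_bits s t (Suc (2 * k)) = t k"
  by (simp_all add: pair_bits_def)

lemma pair_bits_split: "pair_bits (\<lambda>k. s (2 * k)) (\<lambda>k. s (Suc (2 * k))) = s"
  by (auto simp: fun_eq_iff pair_bits_def elim!: evenE oddE)

lemma measurable_reindex_bits: "(\<lambda>s k. s (g k)) \<in> measurable bit_space bit_space"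
  by (rule measurable_PiM_single') (auto simp: space_PiM PiE_UNIV_domain)

context ball_coding
begin

text \<open>Each entry of the list forbids one value of one bit. Forbidden values describe every
  finite-dimensional cylinder, the empty one included, and lists make the cells countable.\<close>

definition cell :: "(nat \<times> bool) list \<Rightarrow> 'a set" where
  "cell l = {y. \<forall>(j, b) \<in> set l. encode y j \<noteq> b}"

lemma continuity_set_cell:
  assumes "\<eta> \<in> prob_measures" "\<And>i m. continuity_set \<eta> (ball (x i) (r i m))"
  shows "continuity_set \<eta> (cell l)"
proof (induction l)
  case Nil
  then show ?case by (simp add: cell_def continuity_set_UNIV)
next
  case (Cons p l)
  obtain j b where p: "p = (j, b)" by force
  have "continuity_set \<eta> (code_ball j)" using assms(2) by (auto simp: code_ball_def split: prod.split)
  then have "continuity_set \<eta> (if b then - code_ball j else code_ball j)" using continuity_set_Compl by auto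
  moreover have "cell (p # l) = (if b then - code_ball j else code_ball j) \<inter> cell l"
    by (auto simp: p cell_def encode_def)
  ultimately show ?case using continuity_set_Int[OF assms(1)] Cons.IH by simp
qed

lemma measurable_cell [measurable]: "cell l \<in> sets borel"
proof (induction l)
  case (Cons p l)
  have "{y \<in> space borel. encode y (fst p) \<noteq> snd p} \<in> sets borel" by measurable
  moreover have "cell (p # l) = {y \<in> space borel. encode y (fst p) \<noteq> snd p} \<inter> cell l"
    by (auto simp: cell_def)
  ultimately show ?case using Cons by simp
qed (simp add: cell_def)

lemma bit_cylinder_cell:
  fixes S :: "nat \<Rightarrow> bool set"
  assumes "finite J"
  obtains l where "\<And>s. s \<in> prod_emb UNIV (\<lambda>_. count_space UNIV) J (Pi\<^sub>E J S) \<longleftrightarrow> (\<forall>(j, b) \<in> set l. s j \<noteq> b)"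
proof -
  have "{(j, b). j \<in> J \<and> b \<notin> S j} \<subseteq> J \<times> (UNIV :: bool set)" by auto
  then have "finite {(j, b). j \<in> J \<and> b \<notin> S j}"
    by (rule finite_subset) (use assms in simp)
  then obtain l where l: "set l = {(j, b). j \<in> J \<and> b \<notin> S j}"
    using finite_list by blast
  have "s \<in> prod_emb UNIV (\<lambda>_. count_space UNIV) J (Pi\<^sub>E J S) \<longleftrightarrow> (\<forall>j\<in>J. s j \<in> S j)" for s
    by (auto simp: prod_emb_def PiE_iff)
  also have "(\<forall>j\<in>J. s j \<in> S j) \<longleftrightarrow> (\<forall>(j, b) \<in> set l. s j \<noteq> b)" for s
    unfolding l by blast
  finally show ?thesis by (rule that)
qed

text \<open>Cylinders determine a law on \<open>bit_space\<close>. Pulled back along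
  \<open>encode\<close> a cylinder is a cell, so its masses under the marginals of
  \<open>Q n\<close> converge both to the \<eta>-side by \<open>lim\<close> and to the
  \<Lambda>-side by \<open>conv\<close>. The map \<open>g\<close> selects the bits of one of the two
  points.\<close>

lemma marginal_limit:
  fixes Q :: "nat \<Rightarrow> (nat \<Rightarrow> bool) measure" and p :: "nat \<Rightarrow> 'a measure" and g :: "nat \<Rightarrow> nat"
  assumes \<Lambda>: "prob_space \<Lambda>" "sets \<Lambda> = sets bit_space"
    and Q: "\<And>n. sets (Q n) = sets bit_space"
    and \<eta>: "\<eta> \<in> prob_measures" and p: "\<And>n. p n \<in> prob_measures"
    and marg: "\<And>n. distr (Q n) bit_space (\<lambda>s k. s (g k)) = distr (p n) bit_space encode"
    and lim: "\<And>l. (\<lambda>n. measure (p n) (cell l)) \<longlonglongrightarrow> measure \<eta> (cell l)"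
    and conv: "\<And>(f :: (nat \<Rightarrow> bool) \<Rightarrow> real) N. depends_below f N \<Longrightarrow>
      (\<lambda>n. \<integral>s. f s \<partial>Q n) \<longlonglongrightarrow> (\<integral>s. f s \<partial>\<Lambda>)"
  shows "distr \<Lambda> bit_space (\<lambda>s k. s (g k)) = distr \<eta> bit_space encode"
proof (rule measure_eqI_PiM_infinite)
  note [measurable] = measurable_reindex_bits[of g]
  note [measurable_cong] = \<Lambda>(2) Q prob_measuresD(2)[OF \<eta>] prob_measuresD(2)[OF p]
  interpret \<Lambda>: prob_space \<Lambda> by fact
  interpret \<eta>: prob_space \<eta> using prob_measuresD[OF \<eta>] by auto
  interpret D: prob_space "distr \<Lambda> bit_space (\<lambda>s k. s (g k))" by (intro \<Lambda>.prob_space_distr) measurable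
  interpret E: prob_space "distr \<eta> bit_space encode" by (intro \<eta>.prob_space_distr) measurable
  show "finite_measure (distr \<Lambda> bit_space (\<lambda>s k. s (g k)))"
    by (rule D.finite_measure_axioms)
  fix S :: "nat \<Rightarrow> bool set" and J :: "nat set" assume J: "finite J"
  let ?C = "prod_emb UNIV (\<lambda>_. count_space UNIV) J (Pi\<^sub>E J S) :: (nat \<Rightarrow> bool) set"
  obtain l where l: "\<And>s. s \<in> ?C \<longleftrightarrow> (\<forall>(j, b) \<in> set l. s j \<noteq> b)"
    using bit_cylinder_cell[OF J] by blast
  have C [measurable]: "?C \<in> sets bit_space" using J by (intro sets_PiM_I) auto
  have enc: "measure (distr P bit_space encode) ?C = measure P (cell l)" if "P \<in> prob_measures" for P
    using prob_measuresD[OF that] by (subst measure_distr) (auto simp: l cell_def vimage_def)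
  have ind: "(\<integral>s. indicator ?C (\<lambda>k. s (g k)) \<partial>P) = measure (distr P bit_space (\<lambda>s k. s (g k))) ?C"
    if P: "sets P = sets bit_space" for P
  proof -
    have m: "(\<lambda>s k. s (g k)) \<in> measurable P bit_space"
      using measurable_reindex_bits[of g] measurable_cong_sets[OF P refl] by blast
    have "(\<integral>s. indicator ?C (\<lambda>k. s (g k)) \<partial>P) = (\<integral>s. indicator ?C s \<partial>distr P bit_space (\<lambda>s k. s (g k)) :: real)"
      using borel_measurable_indicator[OF C] by (intro integral_distr[OF m, symmetric])
    then show ?thesis by (simp add: space_PiM)
  qed
  \<comment> \<open>Only the positions \<open>g j\<close> are inspected. Their sum bounds each of
    them, and \<open>Suc\<close> makes the bound strict.\<close>
  have "depends_below (\<lambda>s. indicator ?C (\<lambda>k. s (g k)) :: real) (Suc (\<Sum>(j, b)\<leftarrow>l. g j))"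
  proof -
    have le: "g j < Suc (\<Sum>(j, b)\<leftarrow>l. g j)" if "(j, b) \<in> set l" for j b
      using member_le_sum_list[of "g j" "map (\<lambda>(j, b). g j) l"] that by force
    have "(\<lambda>k. s (g k)) \<in> ?C \<longleftrightarrow> (\<lambda>k. s' (g k)) \<in> ?C"
      if "\<forall>k<Suc (\<Sum>(j, b)\<leftarrow>l. g j). s k = s' k" for s s'
      unfolding l using le that by fastforce
    then show ?thesis unfolding depends_below_def by (auto simp: indicator_def)
  qed
  from conv[OF this] have "(\<lambda>n. measure (p n) (cell l)) \<longlonglongrightarrow> measure (distr \<Lambda> bit_space (\<lambda>s k. s (g k))) ?C"
    by (simp add: ind \<Lambda> Q marg enc p)
  from LIMSEQ_unique[OF this lim]
  have "measure (distr \<Lambda> bit_space (\<lambda>s k. s (g k))) ?C = measure (distr \<eta> bit_space encode) ?C"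
    by (simp add: enc \<eta>)
  then show "emeasure (distr \<Lambda> bit_space (\<lambda>s k. s (g k))) ?C = emeasure (distr \<eta> bit_space encode) ?C"
    by (simp add: D.emeasure_eq_measure E.emeasure_eq_measure)
qed simp_all

text \<open>Both claims concern only the law of the selected bits. By \<open>eq\<close> it is the
  law of \<open>encode\<close> under \<eta>, where \<open>point\<close> inverts
  \<open>encode\<close>.\<close>

lemma AE_encode_point:
  assumes \<Lambda>: "sets \<Lambda> = sets bit_space" and \<eta>: "\<eta> \<in> prob_measures"
    and eq: "distr \<Lambda> bit_space (\<lambda>s k. s (g k)) = distr \<eta> bit_space encode"
  shows "AE s in \<Lambda>. encode (point (\<lambda>k. s (g k))) = (\<lambda>k. s (g k))"
    and "distr \<Lambda> borel (\<lambda>s. point (\<lambda>k. s (g k))) = \<eta>"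
proof -
  note [measurable] = measurable_reindex_bits[of g]
  note [measurable_cong] = \<Lambda> prob_measuresD(2)[OF \<eta>]
  have g: "(\<lambda>s k. s (g k)) \<in> measurable \<Lambda> bit_space" and enc: "encode \<in> measurable \<eta> bit_space"
    by measurable
  \<comment> \<open>Equality of bit sequences is a countable conjunction of coordinate
    events.\<close>
  have meas: "{s \<in> space bit_space. encode (point s) = s} \<in> sets bit_space"
    unfolding fun_eq_iff by measurable
  have "AE s in distr \<eta> bit_space encode. encode (point s) = s"
    by (simp add: AE_distr_iff[OF enc meas] point_encode)
  then have "AE s in distr \<Lambda> bit_space (\<lambda>s k. s (g k)). encode (point s) = s"
    by (simp only: eq)
  then show "AE s in \<Lambda>. encode (point (\<lambda>k. s (g k))) = (\<lambda>k. s (g k))"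
    by (rule AE_distr_iff[OF g meas, THEN iffD1])
  have "distr \<Lambda> borel (\<lambda>s. point (\<lambda>k. s (g k))) = distr (distr \<Lambda> bit_space (\<lambda>s k. s (g k))) borel point"
    by (subst distr_distr) (auto simp: o_def)
  also have "\<dots> = distr \<eta> borel (\<lambda>y. point (encode y))"
    unfolding eq by (subst distr_distr) (auto simp: o_def)
  also have "\<dots> = \<eta>" using distr_id2[of borel \<eta>] prob_measuresD(2)[OF \<eta>] by (simp add: point_encode)
  finally show "distr \<Lambda> borel (\<lambda>s. point (\<lambda>k. s (g k))) = \<eta>" .
qed

section \<open>Coding pairs of points and decoding the limit law\<close>

definition encode_pair :: "'a \<times> 'a \<Rightarrow> nat \<Rightarrow> bool" where
  "encode_pair z = pair_bits (encode (fst z)) (encode (snd z))"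

lemma measurable_encode_pair [measurable]: "encode_pair \<in> measurable borel bit_space"
proof (rule measurable_PiM_single')
  fix k
  have [measurable]: "(fst :: 'a \<times> 'a \<Rightarrow> 'a) \<in> borel \<rightarrow>\<^sub>M borel" "(snd :: 'a \<times> 'a \<Rightarrow> 'a) \<in> borel \<rightarrow>\<^sub>M borel"
    unfolding borel_prod[symmetric] by measurable
  show "(\<lambda>z. encode_pair z k) \<in> borel \<rightarrow>\<^sub>M count_space UNIV"
    unfolding encode_pair_def pair_bits_def by measurable
qed (simp add: space_PiM PiE_UNIV_domain)

text \<open>Compactness is applied to the laws of the interleaved codes under
  \<open>\<pi> n\<close>. The even and odd bits of the limit \<Lambda> have the laws of codes under
  \<eta> and \<nu>, so decoding both halves gives a coupling, and recoding it returns
  \<Lambda>-almost every sequence unchanged.\<close>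

lemma couplings_limit:
  assumes \<eta>: "\<eta> \<in> prob_measures" and \<nu>: "\<nu> \<in> prob_measures"
    and \<pi>: "\<And>n. \<pi> n \<in> couplings (\<eta>' n) (\<nu>' n)"
    and \<eta>': "\<And>n. \<eta>' n \<in> prob_measures" and \<nu>': "\<And>n. \<nu>' n \<in> prob_measures"
    and lim\<eta>: "\<And>l. (\<lambda>n. measure (\<eta>' n) (cell l)) \<longlonglongrightarrow> measure \<eta> (cell l)"
    and lim\<nu>: "\<And>l. (\<lambda>n. measure (\<nu>' n) (cell l)) \<longlonglongrightarrow> measure \<nu> (cell l)"
  obtains q \<pi>\<^sub>0 where "strict_mono (q :: nat \<Rightarrow> nat)" "\<pi>\<^sub>0 \<in> couplings \<eta> \<nu>"
    "\<And>(f :: (nat \<Rightarrow> bool) \<Rightarrow> real) N. depends_below f N \<Longrightarrow> f \<in> borel_measurable bit_space \<Longrightarrow>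
      (\<lambda>n. \<integral>z. f (encode_pair z) \<partial>\<pi> (q n)) \<longlonglongrightarrow> (\<integral>z. f (encode_pair z) \<partial>\<pi>\<^sub>0)"
proof -
  have [measurable]: "(fst :: 'a \<times> 'a \<Rightarrow> 'a) \<in> borel \<rightarrow>\<^sub>M borel" "(snd :: 'a \<times> 'a \<Rightarrow> 'a) \<in> borel \<rightarrow>\<^sub>M borel"
    unfolding borel_prod[symmetric] by measurable
  note [measurable] = measurable_reindex_bits[of "\<lambda>k. 2 * k"] measurable_reindex_bits[of "\<lambda>k. Suc (2 * k)"]
  have \<pi>_prob: "\<pi> n \<in> prob_measures" and fst_\<pi>: "distr (\<pi> n) borel fst = \<eta>' n"
    and snd_\<pi>: "distr (\<pi> n) borel snd = \<nu>' n" for n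
    using \<pi>[of n] by (auto simp: couplings_def)
  note [measurable_cong] = prob_measuresD(2)[OF \<pi>_prob]
  define Q where "Q n = distr (\<pi> n) bit_space encode_pair" for n
  have Q: "prob_space (Q n)" "sets (Q n) = sets bit_space" for n
    unfolding Q_def using prob_measuresD[OF \<pi>_prob] by (auto intro!: prob_space.prob_space_distr)
  obtain q \<Lambda> where q: "strict_mono (q :: nat \<Rightarrow> nat)" and \<Lambda>: "prob_space \<Lambda>" "sets \<Lambda> = sets bit_space"
    and conv: "\<And>(f :: (nat \<Rightarrow> bool) \<Rightarrow> real) N. depends_below f N \<Longrightarrow>
      (\<lambda>n. \<integral>s. f s \<partial>Q (q n)) \<longlonglongrightarrow> (\<integral>s. f s \<partial>\<Lambda>)"
    using bit_space_compact[of Q] Q by blast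
  note [measurable_cong] = \<Lambda>(2)
  have "distr (Q n) bit_space (\<lambda>s k. s (2 * k)) = distr (\<eta>' n) bit_space encode" for n
    unfolding Q_def fst_\<pi>[symmetric]
    by (subst (1 2) distr_distr) (auto simp: o_def encode_pair_def)
  note marg_fst = this
  have lim_fst: "(\<lambda>n. measure (\<eta>' (q n)) (cell l)) \<longlonglongrightarrow> measure \<eta> (cell l)" for l
    using LIMSEQ_subseq_LIMSEQ[OF lim\<eta> q] by (simp add: o_def)
  have eq_fst: "distr \<Lambda> bit_space (\<lambda>s k. s (2 * k)) = distr \<eta> bit_space encode"
    by (rule marginal_limit[where Q="\<lambda>n. Q (q n)" and p="\<lambda>n. \<eta>' (q n)"]; rule \<Lambda> Q \<eta> \<eta>' marg_fst lim_fst conv)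
  have "distr (Q n) bit_space (\<lambda>s k. s (Suc (2 * k))) = distr (\<nu>' n) bit_space encode" for n
    unfolding Q_def snd_\<pi>[symmetric]
    by (subst (1 2) distr_distr) (auto simp: o_def encode_pair_def)
  note marg_snd = this
  have lim_snd: "(\<lambda>n. measure (\<nu>' (q n)) (cell l)) \<longlonglongrightarrow> measure \<nu> (cell l)" for l
    using LIMSEQ_subseq_LIMSEQ[OF lim\<nu> q] by (simp add: o_def)
  have eq_snd: "distr \<Lambda> bit_space (\<lambda>s k. s (Suc (2 * k))) = distr \<nu> bit_space encode"
    by (rule marginal_limit[where Q="\<lambda>n. Q (q n)" and p="\<lambda>n. \<nu>' (q n)"]; rule \<Lambda> Q \<nu> \<nu>' marg_snd lim_snd conv)
  define h where "h s = (point (\<lambda>k. s (2 * k)), point (\<lambda>k. s (Suc (2 * k))))" for s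
  have h [measurable]: "h \<in> borel_measurable bit_space"
    unfolding h_def borel_prod[symmetric] by measurable
  have ae: "AE s in \<Lambda>. encode_pair (h s) = s"
    using AE_encode_point(1)[OF \<Lambda>(2) \<eta> eq_fst] AE_encode_point(1)[OF \<Lambda>(2) \<nu> eq_snd]
    by eventually_elim (simp add: encode_pair_def h_def pair_bits_split)
  define \<pi>\<^sub>0 where "\<pi>\<^sub>0 = distr \<Lambda> borel h"
  show ?thesis
  proof (rule that[OF q, of \<pi>\<^sub>0])
    have "\<pi>\<^sub>0 \<in> prob_measures"
      unfolding \<pi>\<^sub>0_def prob_measures_def using prob_space.prob_space_distr[OF \<Lambda>(1), of h borel] by simp
    moreover have "distr \<pi>\<^sub>0 borel fst = \<eta>" "distr \<pi>\<^sub>0 borel snd = \<nu>"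
      unfolding \<pi>\<^sub>0_def using AE_encode_point(2)[OF \<Lambda>(2) \<eta> eq_fst] AE_encode_point(2)[OF \<Lambda>(2) \<nu> eq_snd]
      by (auto simp: distr_distr o_def h_def)
    ultimately show "\<pi>\<^sub>0 \<in> couplings \<eta> \<nu>" by (simp add: couplings_def)
    fix f :: "(nat \<Rightarrow> bool) \<Rightarrow> real" and N
    assume f: "depends_below f N" and [measurable]: "f \<in> borel_measurable bit_space"
    have "(\<integral>z. f (encode_pair z) \<partial>\<pi>\<^sub>0) = (\<integral>s. f (encode_pair (h s)) \<partial>\<Lambda>)"
      unfolding \<pi>\<^sub>0_def by (rule integral_distr) measurable
    also have "\<dots> = (\<integral>s. f s \<partial>\<Lambda>)"
      using ae by (intro integral_cong_AE) (auto elim!: eventually_mono)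
    finally have "(\<integral>z. f (encode_pair z) \<partial>\<pi>\<^sub>0) = (\<integral>s. f s \<partial>\<Lambda>)" .
    moreover have "(\<integral>z. f (encode_pair z) \<partial>\<pi> n) = (\<integral>s. f s \<partial>Q n)" for n
      unfolding Q_def by (rule integral_distr[symmetric]) measurable
    ultimately show "(\<lambda>n. \<integral>z. f (encode_pair z) \<partial>\<pi> (q n)) \<longlonglongrightarrow> (\<integral>z. f (encode_pair z) \<partial>\<pi>\<^sub>0)"
      using conv[OF f] by simp
  qed
qed

end

subsection \<open>Lower semicontinuity of the transport cost\<close>

text \<open>On the code of a pair this is the maximum of 0 and \<open>q j\<close> times the
  indicator of the product of base balls \<open>K j\<close> and \<open>L j\<close>, over
  \<open>j < n\<close>. Even bits describe the first point, odd bits the second.\<close>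

primrec rect_max :: "(nat \<Rightarrow> real) \<Rightarrow> (nat \<Rightarrow> nat) \<Rightarrow> (nat \<Rightarrow> nat) \<Rightarrow> nat \<Rightarrow> (nat \<Rightarrow> bool) \<Rightarrow> real" where
  "rect_max q K L 0 s = 0"
| "rect_max q K L (Suc n) s = max (rect_max q K L n s) (q n * of_bool (s (2 * K n) \<and> s (Suc (2 * L n))))"

lemma rect_max_nonneg: "0 \<le> rect_max q K L n s"
  by (induction n) auto

lemma rect_max_le: "rect_max q K L n s \<le> (\<Sum>j<n. \<bar>q j\<bar>)"
proof (induction n)
  case (Suc n)
  have "0 \<le> (\<Sum>j<n. \<bar>q j\<bar>)" by (intro sum_nonneg) auto
  moreover have "q n * of_bool b \<le> \<bar>q n\<bar>" for b by auto
  ultimately show ?case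
    unfolding rect_max.simps sum.lessThan_Suc using Suc
    by (intro max.boundedI) (auto intro: add_increasing add_increasing2)
qed simp

lemma measurable_rect_max [measurable]: "rect_max q K L n \<in> borel_measurable bit_space"
proof (induction n)
  case (Suc n)
  note [measurable] = Suc
  show ?case by simp
qed simp

lemma depends_below_rect_max: "\<exists>N. depends_below (rect_max q K L n) N"
proof (induction n)
  case 0
  then show ?case by (auto simp: depends_below_def)
next
  case (Suc n)
  then obtain N where N: "depends_below (rect_max q K L n) N" by blast
  have "depends_below (rect_max q K L (Suc n)) (max N (Suc (max (2 * K n) (Suc (2 * L n)))))"
    unfolding depends_below_def
  proof (intro allI impI)
    fix s s' :: "nat \<Rightarrow> bool"
    assume eq: "\<forall>k<max N (Suc (max (2 * K n) (Suc (2 * L n)))). s k = s' k"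
    then have "rect_max q K L n s = rect_max q K L n s'"
      using N by (simp add: depends_below_def)
    moreover have "s (2 * K n) = s' (2 * K n)" "s (Suc (2 * L n)) = s' (Suc (2 * L n))"
      using eq by auto
    ultimately show "rect_max q K L (Suc n) s = rect_max q K L (Suc n) s'" by simp
  qed
  then show ?case by blast
qed

context ball_coding
begin

text \<open>By lower semicontinuity, a rational strictly below the cost at \<open>z\<close> stays
  below it on some product of base balls around \<open>z\<close>. The triples of two balls and a
  rational are countable, and the maxima over initial segments of their enumeration increase to the
  cost.\<close>

lemma cost_function_rect_max:
  fixes c :: "'a \<Rightarrow> 'a \<Rightarrow> ennreal"
  assumes "cost_function c"
  obtains q K L where "\<And>z. c (fst z) (snd z) = (SUP n. ennreal (rect_max q K L n (encode_pair z)))"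
proof -
  define K :: "nat \<Rightarrow> nat" where "K j = fst (from_nat j :: nat \<times> nat \<times> rat)" for j
  define L :: "nat \<Rightarrow> nat" where "L j = fst (snd (from_nat j :: nat \<times> nat \<times> rat))" for j
  define p :: "nat \<Rightarrow> real" where "p j = of_rat (snd (snd (from_nat j :: nat \<times> nat \<times> rat)))" for j
  \<comment> \<open>A height that is no lower bound of the cost on its rectangle is replaced by 0.
    Negative heights pass the test, since \<open>ennreal\<close> sends them to 0; the maximum with 0
    in \<open>rect_max\<close> absorbs them.\<close>
  define q where "q j = (if \<forall>a\<in>code_ball (K j). \<forall>b\<in>code_ball (L j). ennreal (p j) \<le> c a b then p j else 0)" for j
  have upper: "ennreal (rect_max q K L n (encode_pair z)) \<le> c (fst z) (snd z)" for n z
  proof (induction n)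
    case (Suc n)
    have "ennreal (q n * of_bool (encode_pair z (2 * K n) \<and> encode_pair z (Suc (2 * L n)))) \<le> c (fst z) (snd z)"
      by (auto simp: q_def encode_pair_def encode_def)
    then show ?case using Suc by (auto simp: max_def)
  qed simp
  have lower: "c (fst z) (snd z) \<le> (SUP n. ennreal (rect_max q K L n (encode_pair z)))" for z
  proof (rule dense_le)
    fix t assume "t < c (fst z) (snd z)"
    then obtain u :: rat where u: "t < ennreal (of_rat u)" "ennreal (of_rat u) < c (fst z) (snd z)"
      using ennreal_rat_dense by blast
    define U where "U = {z. ennreal (of_rat u) < c (fst z) (snd z)}"
    have "open U"
      using assms unfolding cost_function_def lsc_on_def U_def by simp
    moreover have "z \<in> U" using u(2) by (simp add: U_def)
    ultimately obtain S T where ST: "open S" "open T" "z \<in> S \<times> T" "S \<times> T \<subseteq> U"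
      by (rule open_prod_elim)
    have z: "fst z \<in> S" "snd z \<in> T" using ST(3) by (auto simp: mem_Times_iff)
    obtain k where k: "fst z \<in> code_ball k" "code_ball k \<subseteq> S" using code_ball_basis[OF ST(1) z(1)] .
    obtain l where l: "snd z \<in> code_ball l" "code_ball l \<subseteq> T" using code_ball_basis[OF ST(2) z(2)] .
    define j where "j = to_nat (k, l, u)"
    have "code_ball k \<times> code_ball l \<subseteq> U" using k l ST by blast
    then have "\<forall>a\<in>code_ball k. \<forall>b\<in>code_ball l. ennreal (of_rat u) \<le> c a b"
      unfolding U_def by (force intro: less_imp_le)
    then have "q j = of_rat u" by (simp add: q_def j_def K_def L_def p_def)
    \<comment> \<open>Stage \<open>n\<close> covers the indices below \<open>n\<close>, hence
      \<open>Suc j\<close>.\<close>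
    then have "of_rat u \<le> rect_max q K L (Suc j) (encode_pair z)"
      using k l by (simp add: encode_pair_def encode_def j_def K_def L_def)
    then have "ennreal (of_rat u) \<le> ennreal (rect_max q K L (Suc j) (encode_pair z))"
      by (rule ennreal_leI)
    also have "\<dots> \<le> (SUP n. ennreal (rect_max q K L n (encode_pair z)))"
      by (rule SUP_upper) simp
    finally show "t \<le> (SUP n. ennreal (rect_max q K L n (encode_pair z)))" using u by simp
  qed
  show ?thesis
    by (rule that[of q K L]) (intro antisym lower SUP_least upper)
qed

text \<open>The limit coupling competes in the infimum. For fixed \<open>k\<close>,
  \<open>rect_max q K L k\<close> is bounded and depends on finitely many bits, so its integral
  passes to the limit in \<open>n\<close> and is at most \<open>t\<close>; monotone convergence in
  \<open>k\<close> then bounds the whole cost.\<close>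

lemma OT_cost_limit:
  assumes \<eta>: "\<eta> \<in> prob_measures" and \<nu>: "\<nu> \<in> prob_measures" and c: "cost_function c"
    and \<pi>: "\<And>n. \<pi> n \<in> couplings (\<eta>' n) (\<nu>' n)"
    and \<eta>': "\<And>n. \<eta>' n \<in> prob_measures" and \<nu>': "\<And>n. \<nu>' n \<in> prob_measures"
    and lim\<eta>: "\<And>l. (\<lambda>n. measure (\<eta>' n) (cell l)) \<longlonglongrightarrow> measure \<eta> (cell l)"
    and lim\<nu>: "\<And>l. (\<lambda>n. measure (\<nu>' n) (cell l)) \<longlonglongrightarrow> measure \<nu> (cell l)"
    and t: "0 \<le> t" and cost: "\<And>n. (\<integral>\<^sup>+ z. c (fst z) (snd z) \<partial>\<pi> n) \<le> ennreal (t + 1 / (real n + 1))"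
  shows "OT_cost c \<eta> \<nu> \<le> ennreal t"
proof -
  obtain q K L where c_eq: "\<And>z. c (fst z) (snd z) = (SUP n. ennreal (rect_max q K L n (encode_pair z)))"
    using cost_function_rect_max[OF c] by blast
  obtain r \<pi>\<^sub>0 where r: "strict_mono (r :: nat \<Rightarrow> nat)" and \<pi>\<^sub>0: "\<pi>\<^sub>0 \<in> couplings \<eta> \<nu>"
    and conv: "\<And>(f :: (nat \<Rightarrow> bool) \<Rightarrow> real) N. depends_below f N \<Longrightarrow> f \<in> borel_measurable bit_space \<Longrightarrow>
      (\<lambda>n. \<integral>z. f (encode_pair z) \<partial>\<pi> (r n)) \<longlonglongrightarrow> (\<integral>z. f (encode_pair z) \<partial>\<pi>\<^sub>0)"
    using couplings_limit[OF \<eta> \<nu> \<pi> \<eta>' \<nu>' lim\<eta> lim\<nu>] by blast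
  let ?f = "\<lambda>k z. rect_max q K L k (encode_pair z)"
  have meas: "?f k \<in> borel_measurable P" if "P \<in> prob_measures" for P k
    using measurable_compose[OF measurable_encode_pair measurable_rect_max]
    by (simp add: measurable_cong_sets[OF prob_measuresD(2)[OF that] refl])
  have nn: "(\<integral>\<^sup>+ z. ennreal (?f k z) \<partial>P) = ennreal (\<integral>z. ?f k z \<partial>P)"
    if "P \<in> prob_measures" for P k
  proof -
    interpret prob_space P using prob_measuresD[OF that] by auto
    show ?thesis
      by (intro nn_integral_eq_integral integrable_const_bound[where B="\<Sum>j<k. \<bar>q j\<bar>"] meas that AE_I2)
         (simp_all add: rect_max_nonneg rect_max_le)
  qed
  have le: "(\<integral>z. ?f k z \<partial>\<pi>\<^sub>0) \<le> t" for k
  proof -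
    obtain N where "depends_below (rect_max q K L k) N" using depends_below_rect_max by blast
    then have "(\<lambda>n. \<integral>z. ?f k z \<partial>\<pi> (r n)) \<longlonglongrightarrow> (\<integral>z. ?f k z \<partial>\<pi>\<^sub>0)"
      by (rule conv) (rule measurable_rect_max)
    moreover have "(\<lambda>n. t + 1 / (real (r n) + 1)) \<longlonglongrightarrow> t + 0"
      using LIMSEQ_subseq_LIMSEQ[OF LIMSEQ_inverse_real_of_nat r]
      by (intro tendsto_add tendsto_const) (simp add: o_def inverse_eq_divide add.commute)
    moreover have "(\<integral>z. ?f k z \<partial>\<pi> n) \<le> t + 1 / (real n + 1)" for n
    proof -
      have "ennreal (\<integral>z. ?f k z \<partial>\<pi> n) = (\<integral>\<^sup>+ z. ennreal (?f k z) \<partial>\<pi> n)"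
        using \<pi>[of n] by (subst nn) (auto simp: couplings_def)
      also have "\<dots> \<le> (\<integral>\<^sup>+ z. c (fst z) (snd z) \<partial>\<pi> n)"
        unfolding c_eq by (intro nn_integral_mono SUP_upper) auto
      also note cost
      finally show ?thesis using t by (subst (asm) ennreal_le_iff) auto
    qed
    ultimately show ?thesis by (intro LIMSEQ_le[where X="\<lambda>n. \<integral>z. ?f k z \<partial>\<pi> (r n)"]) auto
  qed
  have \<pi>\<^sub>0_prob: "\<pi>\<^sub>0 \<in> prob_measures" using \<pi>\<^sub>0 by (auto simp: couplings_def)
  have "incseq (\<lambda>k z. ennreal (?f k z))"
    by (intro incseq_SucI le_funI ennreal_leI) simp
  then have "(\<integral>\<^sup>+ z. c (fst z) (snd z) \<partial>\<pi>\<^sub>0) = (SUP k. \<integral>\<^sup>+ z. ennreal (?f k z) \<partial>\<pi>\<^sub>0)"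
    unfolding c_eq by (intro nn_integral_monotone_convergence_SUP measurable_compose[OF meas[OF \<pi>\<^sub>0_prob] measurable_ennreal])
  also have "\<dots> \<le> ennreal t"
    unfolding nn[OF \<pi>\<^sub>0_prob] by (intro SUP_least ennreal_leI le)
  finally show ?thesis
    unfolding OT_cost_def using \<pi>\<^sub>0 by (intro INF_lower2)
qed

text \<open>The neighbourhood \<open>S n\<close> controls the cells numbered up to \<open>n\<close>
  within \<open>1 / (n + 1)\<close>. It is a finite intersection, hence open, and every cell is
  controlled from some \<open>n\<close> on.\<close>

lemma countable_weak_neighbourhoods:
  assumes \<eta>: "\<eta> \<in> prob_measures" and "\<And>i m. continuity_set \<eta> (ball (x i) (r i m))"
  obtains S where "\<And>n :: nat. openin weak_topology (S n)" "\<And>n. \<eta> \<in> S n"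
    "\<And>P l. (\<And>n. P n \<in> S n) \<Longrightarrow> (\<lambda>n. measure (P n) (cell l)) \<longlonglongrightarrow> measure \<eta> (cell l)"
proof -
  have "\<exists>U. openin weak_topology U \<and> \<eta> \<in> U \<and> (\<forall>P\<in>U. \<bar>measure P (cell l) - measure \<eta> (cell l)\<bar> < 1 / (real n + 1))" for l n
    by (intro weak_neighbourhood continuity_set_cell assms) simp
  then obtain U where U: "\<And>l n. openin weak_topology (U l n)" "\<And>l n. \<eta> \<in> U l n"
    "\<And>l n P. P \<in> U l n \<Longrightarrow> \<bar>measure P (cell l) - measure \<eta> (cell l)\<bar> < 1 / (real n + 1)"
    by metis
  show ?thesis
  proof (rule that[of "\<lambda>n. \<Inter>m\<le>n. U (from_nat m) n"])
    show "openin weak_topology (\<Inter>m\<le>n. U (from_nat m) n)" for n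
      by (intro openin_INT2) (auto simp: U)
    show "\<eta> \<in> (\<Inter>m\<le>n. U (from_nat m) n)" for n using U by auto
    fix P l assume P: "\<And>n. P n \<in> (\<Inter>m\<le>n. U (from_nat m) n)"
    have "\<bar>measure (P n) (cell l) - measure \<eta> (cell l)\<bar> < 1 / (real n + 1)" if "to_nat l \<le> n" for n
      using P[of n] that by (intro U) (auto dest: bspec[of _ _ "to_nat l"])
    then have "eventually (\<lambda>n. norm (measure (P n) (cell l) - measure \<eta> (cell l)) \<le> 1 / (real n + 1)) sequentially"
      by (auto simp: eventually_sequentially intro: less_imp_le)
    moreover have "(\<lambda>n. 1 / (real n + 1)) \<longlonglongrightarrow> 0"
      using LIMSEQ_inverse_real_of_nat by (simp add: inverse_eq_divide add.commute)
    ultimately have "(\<lambda>n. measure (P n) (cell l) - measure \<eta> (cell l)) \<longlonglongrightarrow> 0"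
      by (rule Lim_null_comparison)
    then show "(\<lambda>n. measure (P n) (cell l)) \<longlonglongrightarrow> measure \<eta> (cell l)"
      by (rule LIM_zero_cancel)
  qed
qed

end

text \<open>If no pair of neighbourhoods worked, each \<open>S n\<close> and \<open>T n\<close>
  would contain measures with transport cost at most \<open>t\<close>. Near-optimal couplings of
  these would force the cost at the limit down to \<open>t\<close>.\<close>

lemma OT_cost_lsc:
  fixes c :: "'a::polish_space \<Rightarrow> 'a \<Rightarrow> ennreal"
  assumes c: "cost_function c" and \<eta>: "\<eta> \<in> prob_measures" and \<nu>: "\<nu> \<in> prob_measures"
    and t: "t < OT_cost c \<eta> \<nu>"
  shows "\<exists>S T. openin weak_topology S \<and> \<eta> \<in> S \<and> openin weak_topology T \<and> \<nu> \<in> T \<and>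
    (\<forall>\<eta>'\<in>S. \<forall>\<nu>'\<in>T. t < OT_cost c \<eta>' \<nu>')"
proof (rule ccontr)
  assume neg: "\<not> ?thesis"
  obtain x :: "nat \<Rightarrow> 'a" and r where
    dense: "\<And>U. open U \<Longrightarrow> U \<noteq> {} \<Longrightarrow> \<exists>i. x i \<in> U" and
    r: "\<And>i m. 1 / (real m + 2) < r i m" "\<And>i m. r i m < 1 / (real m + 1)" and
    cont: "\<And>i m. continuity_set \<eta> (ball (x i) (r i m))" "\<And>i m. continuity_set \<nu> (ball (x i) (r i m))"
    using continuity_balls[OF \<eta> \<nu>] by blast
  interpret ball_coding x r by standard (use dense r in auto)
  obtain S where S: "\<And>n :: nat. openin weak_topology (S n)" "\<And>n. \<eta> \<in> S n"
    "\<And>P l. (\<And>n. P n \<in> S n) \<Longrightarrow> (\<lambda>n. measure (P n) (cell l)) \<longlonglongrightarrow> measure \<eta> (cell l)"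
    using countable_weak_neighbourhoods[OF \<eta> cont(1)] by blast
  obtain T where T: "\<And>n :: nat. openin weak_topology (T n)" "\<And>n. \<nu> \<in> T n"
    "\<And>P l. (\<And>n. P n \<in> T n) \<Longrightarrow> (\<lambda>n. measure (P n) (cell l)) \<longlonglongrightarrow> measure \<nu> (cell l)"
    using countable_weak_neighbourhoods[OF \<nu> cont(2)] by blast
  have "\<exists>\<eta>' \<nu>'. \<eta>' \<in> S n \<and> \<nu>' \<in> T n \<and> OT_cost c \<eta>' \<nu>' \<le> t" for n
    using neg S(1,2)[of n] T(1,2)[of n] by (meson not_le)
  then obtain \<eta>' \<nu>' where \<eta>': "\<And>n. \<eta>' n \<in> S n" and \<nu>': "\<And>n. \<nu>' n \<in> T n"
    and le: "\<And>n. OT_cost c (\<eta>' n) (\<nu>' n) \<le> t" by metis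
  have prob: "\<eta>' n \<in> prob_measures" "\<nu>' n \<in> prob_measures" for n
    using \<eta>'[of n] \<nu>'[of n] S(1) T(1) openin_subset by fastforce+
  obtain u where u: "0 \<le> u" "t = ennreal u" using t by (cases t) auto
  \<comment> \<open>The slack \<open>1 / (n + 1)\<close> replaces attainment of the infimum by an
    optimal coupling.\<close>
  have "\<exists>\<pi>\<in>couplings (\<eta>' n) (\<nu>' n). (\<integral>\<^sup>+ z. c (fst z) (snd z) \<partial>\<pi>) < ennreal (u + 1 / (real n + 1))" for n
  proof -
    have "t < ennreal (u + 1 / (real n + 1))" using u by (simp add: ennreal_less_iff)
    with le[of n] have "OT_cost c (\<eta>' n) (\<nu>' n) < ennreal (u + 1 / (real n + 1))" by (rule le_less_trans)
    then show ?thesis unfolding OT_cost_def by (simp only: INF_less_iff)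
  qed
  then obtain \<pi> where \<pi>: "\<And>n. \<pi> n \<in> couplings (\<eta>' n) (\<nu>' n)"
    "\<And>n. (\<integral>\<^sup>+ z. c (fst z) (snd z) \<partial>\<pi> n) < ennreal (u + 1 / (real n + 1))" by metis
  have "OT_cost c \<eta> \<nu> \<le> ennreal u"
    by (rule OT_cost_limit[OF \<eta> \<nu> c \<pi>(1) prob S(3)[OF \<eta>'] T(3)[OF \<nu>'] u(1) less_imp_le[OF \<pi>(2)]])
  with t u show False by simp
qed

section \<open>From the transport cost to the infimal convolution \<open>Dc\<close>\<close>

lemma lsc_add_OT_cost:
  fixes c :: "'a::polish_space \<Rightarrow> 'a \<Rightarrow> ennreal" and F :: "'a measure \<Rightarrow> ennreal"
  assumes c: "cost_function c" and F: "lsc_on weak_topology F"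
    and \<eta>: "\<eta> \<in> prob_measures" and \<nu>: "\<nu> \<in> prob_measures"
    and t: "t < F \<eta> + OT_cost c \<eta> \<nu>"
  shows "\<exists>S T. openin weak_topology S \<and> \<eta> \<in> S \<and> openin weak_topology T \<and> \<nu> \<in> T \<and>
    (\<forall>\<eta>'\<in>S. \<forall>\<nu>'\<in>T. t < F \<eta>' + OT_cost c \<eta>' \<nu>')"
proof -
  have open_F: "openin weak_topology {P \<in> prob_measures. s < F P}" for s
    using F by (simp add: lsc_on_def)
  have \<nu>_top: "openin weak_topology (prob_measures :: 'a measure set)"
    using openin_topspace[of "weak_topology :: 'a measure topology"] by simp
  show ?thesis
  proof (cases "t < F \<eta>")
    case True
    then show ?thesis
      using open_F[of t] \<nu>_top \<eta> \<nu>
      by (intro exI[of _ "{P \<in> prob_measures. t < F P}"] exI[of _ prob_measures])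
         (auto intro: less_le_trans)
  next
    case False
    then have F_le: "F \<eta> \<le> t" by simp
    have t_fin: "t < \<top>" using t by (rule less_le_trans) simp
    with F_le have F_fin: "F \<eta> < \<top>" by (rule le_less_trans)
    have "t - F \<eta> < OT_cost c \<eta> \<nu>"
      using t F_le F_fin by (simp add: minus_less_iff_ennreal add.commute)
    \<comment> \<open>The number \<open>b\<close> divides the threshold: nearby transport costs stay
      above \<open>b\<close>, and \<open>F\<close> has to stay above \<open>t - b\<close>.\<close>
    then obtain b where b: "t - F \<eta> < b" "b < OT_cost c \<eta> \<nu>" using dense by blast
    have tb: "t < F \<eta> + b"
      using b(1) F_le F_fin by (simp add: minus_less_iff_ennreal add.commute)
    obtain S T where ST: "openin weak_topology S" "\<eta> \<in> S" "openin weak_topology T" "\<nu> \<in> T"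
      "\<And>\<eta>' \<nu>'. \<eta>' \<in> S \<Longrightarrow> \<nu>' \<in> T \<Longrightarrow> b < OT_cost c \<eta>' \<nu>'"
      using OT_cost_lsc[OF c \<eta> \<nu> b(2)] by blast
    show ?thesis
    \<comment> \<open>Subtraction in \<open>ennreal\<close> truncates at 0. For \<open>t < b\<close>
      the condition \<open>t - b < F \<eta>\<close> would fail when \<open>F \<eta> = 0\<close>, but
      then the transport term alone exceeds \<open>t\<close>.\<close>
    proof (cases "t < b")
      case True
      then have "t < F \<eta>' + OT_cost c \<eta>' \<nu>'" if "\<eta>' \<in> S" "\<nu>' \<in> T" for \<eta>' \<nu>'
        using ST(5)[OF that] by (metis add.commute le_iff_add less_le_trans less_trans)
      then show ?thesis using ST(1-4) by blast
    next
      case False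
      then have F: "b \<le> t" "b < \<top>" using le_less_trans[OF _ t_fin] by auto
      have "t - b < F \<eta>" using tb F by (simp add: minus_less_iff_ennreal)
      moreover have "t < F \<eta>' + OT_cost c \<eta>' \<nu>'" if "t - b < F \<eta>'" "\<eta>' \<in> S" "\<nu>' \<in> T" for \<eta>' \<nu>'
      proof -
        have "t < F \<eta>' + b" using that(1) F by (simp add: minus_less_iff_ennreal)
        also have "\<dots> \<le> F \<eta>' + OT_cost c \<eta>' \<nu>'"
          using ST(5)[OF that(2,3)] by (intro add_left_mono) simp
        finally show ?thesis .
      qed
      ultimately show ?thesis
        using ST(1-4) open_F[of "t - b"] \<eta>
        by (intro exI[of _ "S \<inter> {P \<in> prob_measures. t - b < F P}"] exI[of _ T]) auto
    qed
  qed
qed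

text \<open>Outside the compact sublevel set \<open>K\<close> the divergence term alone exceeds \<open>u\<close>; on \<open>K\<close> a finite
  subcover makes the choice of the neighbourhood of \<open>\<nu>\<close> uniform.\<close>

theorem theorem3:
  fixes D :: "('a::polish_space) measure \<Rightarrow> 'a measure \<Rightarrow> ennreal"
    and c :: "'a \<Rightarrow> 'a \<Rightarrow> ennreal"
    and \<mu> :: "'a measure"
  assumes "pre_divergence D"
    and "cost_function c"
    and "\<mu> \<in> prob_measures"
    and "lsc_on weak_topology (\<lambda>P. D P \<mu>)"
    and "\<And>t::real. compactin weak_topology {P \<in> topspace weak_topology. D P \<mu> \<le> ennreal t}"
  shows "lsc_on weak_topology (\<lambda>\<nu>. Dc D c \<nu> \<mu>)"
  unfolding lsc_on_def
proof (intro allI openin_subopen[THEN iffD2] ballI)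
  fix t \<nu> assume "\<nu> \<in> {\<nu> \<in> topspace weak_topology. t < Dc D c \<nu> \<mu>}"
  then have \<nu>: "\<nu> \<in> prob_measures" and "t < Dc D c \<nu> \<mu>" by auto
  \<comment> \<open>An infimum of values above \<open>u\<close> is only known to be at least
    \<open>u\<close>; the gap between \<open>t\<close> and \<open>u\<close> restores the strict
    inequality. Being below another value, \<open>u\<close> is also finite, as the compactness
    hypothesis requires.\<close>
  then obtain u where u: "t < u" "u < Dc D c \<nu> \<mu>" using dense by blast
  define K where "K = {P \<in> topspace weak_topology. D P \<mu> \<le> u}"
  have K: "compactin weak_topology K"
    using assms(5)[of "enn2real u"] u(2) unfolding K_def by (cases u) auto
  have "\<exists>S T. openin weak_topology S \<and> \<eta> \<in> S \<and> openin weak_topology T \<and> \<nu> \<in> T \<and>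
    (\<forall>\<eta>'\<in>S. \<forall>\<nu>'\<in>T. u < D \<eta>' \<mu> + OT_cost c \<eta>' \<nu>')" if "\<eta> \<in> K" for \<eta>
  proof (rule lsc_add_OT_cost[OF assms(2,4) _ \<nu>])
    show \<eta>: "\<eta> \<in> prob_measures" using that by (simp add: K_def)
    show "u < D \<eta> \<mu> + OT_cost c \<eta> \<nu>"
      using u(2) INF_lower[OF \<eta>, of "\<lambda>\<eta>. D \<eta> \<mu> + OT_cost c \<eta> \<nu>"] unfolding Dc_def by (rule less_le_trans)
  qed
  then have "\<forall>\<eta>\<in>K. \<exists>S T. openin weak_topology S \<and> \<eta> \<in> S \<and> openin weak_topology T \<and> \<nu> \<in> T \<and>
    (\<forall>\<eta>'\<in>S. \<forall>\<nu>'\<in>T. u < D \<eta>' \<mu> + OT_cost c \<eta>' \<nu>')" by blast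
  from bchoice[OF this] obtain S where "\<forall>\<eta>\<in>K. \<exists>T. openin weak_topology (S \<eta>) \<and> \<eta> \<in> S \<eta> \<and> openin weak_topology T \<and>
    \<nu> \<in> T \<and> (\<forall>\<eta>'\<in>S \<eta>. \<forall>\<nu>'\<in>T. u < D \<eta>' \<mu> + OT_cost c \<eta>' \<nu>')" ..
  from bchoice[OF this] obtain T where
    S: "\<And>\<eta>. \<eta> \<in> K \<Longrightarrow> openin weak_topology (S \<eta>)" "\<And>\<eta>. \<eta> \<in> K \<Longrightarrow> \<eta> \<in> S \<eta>"
    and T: "\<And>\<eta>. \<eta> \<in> K \<Longrightarrow> openin weak_topology (T \<eta>)" "\<And>\<eta>. \<eta> \<in> K \<Longrightarrow> \<nu> \<in> T \<eta>"
    and ST: "\<And>\<eta> \<eta>' \<nu>'. \<eta> \<in> K \<Longrightarrow> \<eta>' \<in> S \<eta> \<Longrightarrow> \<nu>' \<in> T \<eta> \<Longrightarrow> u < D \<eta>' \<mu> + OT_cost c \<eta>' \<nu>'"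
    by blast
  have "\<exists>\<F>. finite \<F> \<and> \<F> \<subseteq> S ` K \<and> K \<subseteq> \<Union>\<F>"
    using K S unfolding compactin_def by (elim conjE allE[of _ "S ` K"] impE) auto
  then obtain E where E: "finite E" "E \<subseteq> K" "K \<subseteq> (\<Union>\<eta>\<in>E. S \<eta>)"
    by (metis finite_subset_image)
  \<comment> \<open>If \<open>K\<close> is empty, \<open>E\<close> may be empty and the intersection
    over it is \<open>UNIV\<close>; intersecting with the whole space keeps the set open in the
    topology.\<close>
  let ?V = "(\<Inter>\<eta>\<in>E. T \<eta>) \<inter> topspace weak_topology"
  show "\<exists>V. openin weak_topology V \<and> \<nu> \<in> V \<and> V \<subseteq> {\<nu> \<in> topspace weak_topology. t < Dc D c \<nu> \<mu>}"
  proof (intro exI[of _ ?V] conjI subsetI)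
    show "openin weak_topology ?V"
      using E T(1) by (intro openin_INT) auto
    show "\<nu> \<in> ?V" using \<nu> T E by auto
    fix \<nu>' assume \<nu>': "\<nu>' \<in> ?V"
    have "u \<le> D \<eta> \<mu> + OT_cost c \<eta> \<nu>'" if \<eta>: "\<eta> \<in> prob_measures" for \<eta>
    proof (cases "\<eta> \<in> K")
      case True
      then obtain \<eta>\<^sub>0 where "\<eta>\<^sub>0 \<in> E" "\<eta> \<in> S \<eta>\<^sub>0" using E by blast
      then show ?thesis using ST[of \<eta>\<^sub>0 \<eta> \<nu>'] E \<nu>' by auto
    next
      case False
      then have "u \<le> D \<eta> \<mu>" using \<eta> by (simp add: K_def)
      then show ?thesis by (rule order_trans) simp
    qed
    then have "u \<le> Dc D c \<nu>' \<mu>" unfolding Dc_def by (rule INF_greatest)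
    with u(1) \<nu>' show "\<nu>' \<in> {\<nu> \<in> topspace weak_topology. t < Dc D c \<nu> \<mu>}" by auto
  qed
qed

end
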